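(* Let $\mathcal{A}$ be a finite abelian group. If $\mu$ is a Borel probability measure on $\mathcal{A}^{\mathbb{Z}}$ that is uniformly mixing and harmonically bounded, then $\mu$ is dispersion mixing.
   Context: Let $\sigma$ be the shift on $\mathcal{A}^{\mathbb{Z}}$, $\sigma^m(\mathbf{a})_\ell=a_{\ell+m}$. Uniformly mixing: $\mu$ is shift-invariant and for every $\epsilon>0$ there is $M>0$ such that for every set $\mathfrak{L}$ depending on finitely many coordinates in $(-\infty,0]$, every set $\mathfrak{R}$ depending on finitely many coordinates in $[0,\infty)$, and every $m>M$, $\left|\mu[\sigma^m(\mathfrak{L})\cap\mathfrak{R}]-\mu[\mathfrak{L}]\,\mu[\mathfrak{R}]\right|<\epsilon$. A character of $\mathcal{A}^{\mathbb{Z}}$ is a continuous homomorphism into the circle group; each has the form $\boldsymbol\chi(\mathbf{a})=\prod_{k\in\mathbb{K}}\chi_k(a_k)$ with $\mathbb{K}\subset\mathbb{Z}$ finite (its support) and each $\chi_k$ a nontrivial character of $\mathcal{A}$. Write $\langle\boldsymbol\chi,\mu\rangle=\int\boldsymbol\chi\,d\mu$. Harmonically bounded: there is $C<1$ such that $|\langle\boldsymbol\chi,\mu\rangle|<C$ for every character $\boldsymbol\chi$ other than the trivial one. For $S>0$, two characters with supports $\mathbb{K},\mathbb{X}$ are $S$-separated if $|k-x|\ge S$ for all $k\in\mathbb{K}$, $x\in\mathbb{X}$. For a nontrivial character $\boldsymbol\chi$, $\mathrm{rank}_S(\boldsymbol\chi)$ is the maximal $R$ such that $\boldsymbol\chi=\boldsymbol\chi_1\cdots\boldsymbol\chi_R$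 for some mutually $S$-separated nontrivial characters $\boldsymbol\chi_i$; for the trivial character put $\mathrm{rank}_S=0$. Dispersion mixing: for every $\epsilon>0$ there exist $S,R>0$ such that every character $\boldsymbol\chi$ with $\mathrm{rank}_S(\boldsymbol\chi)>R$ satisfies $|\langle\boldsymbol\chi,\mu\rangle|<\epsilon$. *)

theory Defs
  imports "HOL-Probability.Probability" "HOL-Library.Function_Algebras"
begin

text \<open>
  The finite abelian group is a type of class finite and ab_group_add carrying the discrete
  topology. Its power over the integers is the type of functions from int: the library supplies
  the product topology on it, and Function_Algebras the pointwise group structure.
\<close>

subsection \<open>Uniform mixing\<close>

definition shift :: "int \<Rightarrow> (int \<Rightarrow> 'a) \<Rightarrow> int \<Rightarrow> 'a" where
  "shift m a = (\<lambda>l. a (l + m))"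

definition shift_invariant :: "(int \<Rightarrow> 'a :: topological_space) measure \<Rightarrow> bool" where
  "shift_invariant \<mu> \<longleftrightarrow> distr \<mu> borel (shift 1) = \<mu>"

definition depends_on_finitely_many :: "int set \<Rightarrow> (int \<Rightarrow> 'a) set \<Rightarrow> bool" where
  "depends_on_finitely_many J L \<longleftrightarrow>
     (\<exists>F\<subseteq>J. finite F \<and> (\<forall>a b. (\<forall>k\<in>F. a k = b k) \<longrightarrow> (a \<in> L \<longleftrightarrow> b \<in> L)))"

definition uniformly_mixing :: "(int \<Rightarrow> 'a :: topological_space) measure \<Rightarrow> bool" where
  "uniformly_mixing \<mu> \<longleftrightarrow> shift_invariant \<mu> \<and>
     (\<forall>\<epsilon>>0. \<exists>M>0. \<forall>L R. depends_on_finitely_many {..0} L \<longrightarrow> depends_on_finitely_many {0..} R \<longrightarrow>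
        (\<forall>m>M. \<bar>measure \<mu> (shift m ` L \<inter> R) - measure \<mu> L * measure \<mu> R\<bar> < \<epsilon>))"

subsection \<open>Characters\<close>

definition character :: "('g :: {ab_group_add, topological_space} \<Rightarrow> complex) \<Rightarrow> bool" where
  "character \<phi> \<longleftrightarrow> continuous_on UNIV \<phi> \<and> (\<forall>x. cmod (\<phi> x) = 1) \<and> (\<forall>x y. \<phi> (x + y) = \<phi> x * \<phi> y)"

definition nontrivial_character ::
  "('g :: {ab_group_add, topological_space} \<Rightarrow> complex) \<Rightarrow> bool" where
  "nontrivial_character \<phi> \<longleftrightarrow> character \<phi> \<and> \<phi> \<noteq> (\<lambda>_. 1)"

definition product_form ::
  "((int \<Rightarrow> 'a :: {ab_group_add, topological_space}) \<Rightarrow> complex) \<Rightarrow>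
    int set \<Rightarrow> (int \<Rightarrow> 'a \<Rightarrow> complex) \<Rightarrow> bool" where
  "product_form \<phi> K c \<longleftrightarrow>
     finite K \<and> (\<forall>k\<in>K. nontrivial_character (c k)) \<and> \<phi> = (\<lambda>a. \<Prod>k\<in>K. c k (a k))"

text \<open>The description is justified by \<open>ex1_product_form\<close> below.\<close>

definition support ::
  "((int \<Rightarrow> 'a :: {ab_group_add, topological_space}) \<Rightarrow> complex) \<Rightarrow> int set" where
  "support \<phi> = (THE K. \<exists>c. product_form \<phi> K c)"

definition separated ::
  "nat \<Rightarrow> ((int \<Rightarrow> 'a :: {ab_group_add, topological_space}) \<Rightarrow> complex) \<Rightarrow>
    ((int \<Rightarrow> 'a) \<Rightarrow> complex) \<Rightarrow> bool" where
  "separated S \<phi> \<psi> \<longleftrightarrow> (\<forall>k\<in>support \<phi>. \<forall>x\<in>support \<psi>. \<bar>k - x\<bar> \<ge> int S)"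

definition separated_factorization ::
  "nat \<Rightarrow> ((int \<Rightarrow> 'a :: {ab_group_add, topological_space}) \<Rightarrow> complex) \<Rightarrow>
    nat \<Rightarrow> (nat \<Rightarrow> (int \<Rightarrow> 'a) \<Rightarrow> complex) \<Rightarrow> bool" where
  "separated_factorization S \<phi> R \<psi> \<longleftrightarrow>
     (\<forall>i<R. nontrivial_character (\<psi> i)) \<and>
     (\<forall>i<R. \<forall>j<R. i \<noteq> j \<longrightarrow> separated S (\<psi> i) (\<psi> j)) \<and>
     \<phi> = (\<lambda>a. \<Prod>i<R. \<psi> i a)"

text \<open>
  For a nontrivial character and \<open>S > 0\<close> the maximum is over a finite nonempty set, see
  \<open>finite_ranks\<close> and \<open>one_in_ranks\<close> below.
\<close>

definition sep_rank ::
  "nat \<Rightarrow> ((int \<Rightarrow> 'a :: {ab_group_add, topological_space}) \<Rightarrow> complex) \<Rightarrow> nat" where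
  "sep_rank S \<phi> = (if \<phi> = (\<lambda>_. 1) then 0 else Max {R. \<exists>\<psi>. separated_factorization S \<phi> R \<psi>})"

subsection \<open>Conditions on the Fourier coefficients\<close>

definition fourier_coeff ::
  "((int \<Rightarrow> 'a :: topological_space) \<Rightarrow> complex) \<Rightarrow> (int \<Rightarrow> 'a) measure \<Rightarrow> complex" where
  "fourier_coeff \<phi> \<mu> = (\<integral>a. \<phi> a \<partial>\<mu>)"

definition harmonically_bounded ::
  "(int \<Rightarrow> 'a :: {ab_group_add, topological_space}) measure \<Rightarrow> bool" where
  "harmonically_bounded \<mu> \<longleftrightarrow>
     (\<exists>C<1. \<forall>\<phi>. nontrivial_character \<phi> \<longrightarrow> cmod (fourier_coeff \<phi> \<mu>) < C)"

definition dispersion_mixing ::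
  "(int \<Rightarrow> 'a :: {ab_group_add, topological_space}) measure \<Rightarrow> bool" where
  "dispersion_mixing \<mu> \<longleftrightarrow>
     (\<forall>\<epsilon>>0. \<exists>S>0. \<exists>R>0. \<forall>\<phi>. character \<phi> \<longrightarrow> sep_rank S \<phi> > R \<longrightarrow> cmod (fourier_coeff \<phi> \<mu>) < \<epsilon>)"

subsection \<open>Well-definedness of support and rank\<close>

lemma character_zero: "character \<phi> \<Longrightarrow> \<phi> 0 = 1"
proof -
  assume c: "character \<phi>"
  then have "\<phi> (0 + 0) = \<phi> 0 * \<phi> 0" "cmod (\<phi> 0) = 1"
    unfolding character_def by blast+
  then show ?thesis by auto
qed

lemma product_form_support:
  fixes \<phi> :: "(int \<Rightarrow> 'a :: {ab_group_add, topological_space}) \<Rightarrow> complex"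
  assumes "product_form \<phi> K c"
  shows "K = {k. \<exists>x. \<phi> (0(k := x)) \<noteq> 1}"
proof -
  have fin: "finite K" and nt: "\<And>k. k \<in> K \<Longrightarrow> nontrivial_character (c k)"
    and eq: "\<phi> = (\<lambda>a. \<Prod>k\<in>K. c k (a k))"
    using assms by (auto simp: product_form_def)
  have z: "c k 0 = 1" if "k \<in> K" for k
    using nt[OF that] character_zero by (auto simp: nontrivial_character_def)
  have "\<phi> (0(k := x)) = (if k \<in> K then c k x else 1)" for k x
  proof -
    have "\<phi> (0(k := x)) = (\<Prod>j\<in>K. if j = k then c k x else 1)"
      unfolding eq by (rule prod.cong) (auto simp: z)
    then show ?thesis using fin by (simp add: prod.delta)
  qed
  moreover have "\<exists>x. c k x \<noteq> 1" if "k \<in> K" for k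
    using nt[OF that] by (auto simp: nontrivial_character_def)
  ultimately show ?thesis by auto
qed

lemma character_restrict:
  fixes \<phi> :: "(int \<Rightarrow> 'a :: {ab_group_add, topological_space}) \<Rightarrow> complex"
  assumes "character \<phi>" "finite F"
  shows "\<phi> (\<lambda>j. if j \<in> F then a j else 0) = (\<Prod>k\<in>F. \<phi> (0(k := a k)))"
  using assms(2)
proof (induction F rule: finite_induct)
  case empty
  have "(\<lambda>j. 0) = (0 :: int \<Rightarrow> 'a)" by auto
  then show ?case using character_zero[OF assms(1)] by simp
next
  case (insert k F)
  have "(\<lambda>j. if j \<in> insert k F then a j else 0)
      = 0(k := a k) + (\<lambda>j. if j \<in> F then a j else 0)"
    using insert by (auto simp: fun_eq_iff)
  then have "\<phi> (\<lambda>j. if j \<in> insert k F then a j else 0)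
      = \<phi> (0(k := a k)) * \<phi> (\<lambda>j. if j \<in> F then a j else 0)"
    using assms(1) unfolding character_def by metis
  then show ?case unfolding insert.IH prod.insert[OF insert.hyps] .
qed

lemma sum_UNIV_const_eq_0: "(\<Sum>y\<in>(UNIV :: 'a :: {finite, ab_group_add} set). x) = (0 :: 'a)"
proof -
  have "(\<Sum>y\<in>UNIV. y :: 'a) = (\<Sum>y\<in>UNIV. x + y)"
    by (rule sum.reindex_bij_witness[of _ "\<lambda>y. x + y" "\<lambda>y. y - x"]) auto
  then show ?thesis by (simp add: sum.distrib)
qed

lemma character_root_of_unity:
  fixes \<phi> :: "(int \<Rightarrow> 'a :: {finite, ab_group_add, topological_space}) \<Rightarrow> complex"
  assumes "character \<phi>"
  shows "\<phi> a ^ CARD('a) = 1"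
proof -
  have "\<phi> (\<lambda>k. \<Sum>y\<in>Y. a k) = \<phi> a ^ card Y" if "finite Y" for Y :: "'a set"
    using that
  proof (induction Y rule: finite_induct)
    case empty
    have "(\<lambda>j. 0) = (0 :: int \<Rightarrow> 'a)" by auto
    then show ?case using character_zero[OF assms] by simp
  next
    case (insert y Y)
    have "(\<lambda>k. \<Sum>y\<in>insert y Y. a k) = a + (\<lambda>k. \<Sum>y\<in>Y. a k)"
      using insert by (auto simp: fun_eq_iff)
    then show ?case using assms insert by (simp add: character_def)
  qed
  from this[of UNIV] show ?thesis
    using character_zero[OF assms] by (simp add: sum_UNIV_const_eq_0 zero_fun_def)
qed

lemma ex_product_form:
  fixes \<phi> :: "(int \<Rightarrow> 'a :: {finite, ab_group_add, discrete_topology}) \<Rightarrow> complex"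
  assumes "character \<phi>"
  shows "\<exists>K c. product_form \<phi> K c"
proof -
  have add: "\<phi> (x + y) = \<phi> x * \<phi> y" and nm: "cmod (\<phi> x) = 1" for x y
    using assms by (auto simp: character_def)
  define N where "N = CARD('a)"
  have "N \<ge> 1" by (simp add: N_def Suc_le_eq)
  define U where "U = - ({z :: complex. z ^ N = 1} - {1})"
  have "open U" unfolding U_def
    using finite_roots_unity[OF \<open>N \<ge> 1\<close>, where ?'a = complex]
    by (intro open_Compl finite_imp_closed) auto
  then have op: "open (\<phi> -` U)"
    using assms continuous_on_open_vimage[of UNIV \<phi>] by (simp add: character_def)
  have zero: "0 \<in> \<phi> -` U" using character_zero[OF assms] by (simp add: U_def)
  obtain X where X: "(0 :: int \<Rightarrow> 'a) \<in> (\<Pi>\<^sub>E i\<in>UNIV. X i)"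
      "finite {i. X i \<noteq> topspace (euclidean :: 'a topology)}" "(\<Pi>\<^sub>E i\<in>UNIV. X i) \<subseteq> \<phi> -` U"
    using product_topology_open_contains_basis[OF op[unfolded open_fun_def] zero] by blast
  define F where "F = {i. X i \<noteq> UNIV}"
  have F: "finite F" using X(2) by (simp add: F_def)
  have one: "\<phi> a = 1" if "\<And>k. k \<in> F \<Longrightarrow> a k = 0" for a
  proof -
    have "a i \<in> X i" for i
      using X(1) that[of i] by (cases "i \<in> F") (auto simp: F_def PiE_def Pi_def)
    then have "a \<in> \<phi> -` U" using X(3) by (auto simp: PiE_def)
    then show ?thesis
      using character_root_of_unity[OF assms, of a] by (simp add: U_def N_def)
  qed
  define c where "c k x = \<phi> (0(k := x))" for k x
  define K where "K = {k\<in>F. \<exists>x. c k x \<noteq> 1}"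
  have "character (c k)" for k
  proof -
    have "0(k := x + y) = 0(k := x) + (0(k := y) :: int \<Rightarrow> 'a)" for x y
      by (auto simp: fun_eq_iff)
    then show ?thesis
      by (simp add: character_def c_def add nm continuous_on_open_vimage open_discrete)
  qed
  then have "nontrivial_character (c k)" if "k \<in> K" for k
    using that by (auto simp: nontrivial_character_def K_def)
  moreover have "\<phi> a = (\<Prod>k\<in>K. c k (a k))" for a
  proof -
    have "a = (\<lambda>j. if j \<in> F then a j else 0) + (\<lambda>j. if j \<in> F then 0 else a j)"
      by (auto simp: fun_eq_iff)
    then have "\<phi> a = \<phi> (\<lambda>j. if j \<in> F then a j else 0) * \<phi> (\<lambda>j. if j \<in> F then 0 else a j)"
      using add by metis
    also have "\<dots> = (\<Prod>k\<in>F. c k (a k))"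
      using one character_restrict[OF assms F] by (simp add: c_def)
    also have "\<dots> = (\<Prod>k\<in>K. c k (a k))"
      using F by (intro prod.mono_neutral_right) (auto simp: K_def)
    finally show ?thesis .
  qed
  ultimately have "product_form \<phi> K c"
    using F by (auto simp: product_form_def K_def)
  then show ?thesis by blast
qed

lemma ex1_product_form:
  fixes \<phi> :: "(int \<Rightarrow> 'a :: {finite, ab_group_add, discrete_topology}) \<Rightarrow> complex"
  assumes "character \<phi>"
  shows "\<exists>!K. \<exists>c. product_form \<phi> K c"
  using ex_product_form[OF assms] product_form_support by blast

lemma support_eq:
  fixes \<phi> :: "(int \<Rightarrow> 'a :: {finite, ab_group_add, discrete_topology}) \<Rightarrow> complex"
  assumes "character \<phi>"
  shows "finite (support \<phi>)" "support \<phi> = {k. \<exists>x. \<phi> (0(k := x)) \<noteq> 1}"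
    "support \<phi> = {} \<longleftrightarrow> \<phi> = (\<lambda>_. 1)"
proof -
  obtain c where c: "product_form \<phi> (support \<phi>) c"
    using theI'[OF ex1_product_form[OF assms]] unfolding support_def by blast
  then show "finite (support \<phi>)" by (simp add: product_form_def)
  show s: "support \<phi> = {k. \<exists>x. \<phi> (0(k := x)) \<noteq> 1}" by (rule product_form_support[OF c])
  show "support \<phi> = {} \<longleftrightarrow> \<phi> = (\<lambda>_. 1)"
  proof
    assume "support \<phi> = {}"
    then show "\<phi> = (\<lambda>_. 1)" using c by (simp add: product_form_def)
  qed (use s in auto)
qed

lemma one_in_ranks:
  assumes "nontrivial_character \<phi>"
  shows "1 \<in> {R. \<exists>\<psi>. separated_factorization S \<phi> R \<psi>}"
  using assms by (auto simp: separated_factorization_def intro!: exI[of _ "\<lambda>_. \<phi>"])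

lemma finite_ranks:
  fixes \<phi> :: "(int \<Rightarrow> 'a :: {finite, ab_group_add, discrete_topology}) \<Rightarrow> complex"
  assumes "nontrivial_character \<phi>" "S > 0"
  shows "finite {R. \<exists>\<psi>. separated_factorization S \<phi> R \<psi>}"
proof (rule finite_subset)
  have ch: "character \<phi>" using assms(1) by (simp add: nontrivial_character_def)
  show "{R. \<exists>\<psi>. separated_factorization S \<phi> R \<psi>} \<subseteq> {..card (support \<phi>)}"
  proof clarsimp
    fix R \<psi>
    assume f: "separated_factorization S \<phi> R \<psi>"
    have chi: "character (\<psi> i)" "\<psi> i \<noteq> (\<lambda>_. 1)" if "i < R" for i
      using f that by (auto simp: separated_factorization_def nontrivial_character_def)
    have disj: "k \<notin> support (\<psi> j)" if "i < R" "j < R" "i \<noteq> j" "k \<in> support (\<psi> i)" for i j k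
    proof
      assume "k \<in> support (\<psi> j)"
      moreover have "separated S (\<psi> i) (\<psi> j)"
        using f that by (auto simp: separated_factorization_def)
      ultimately have "int S \<le> \<bar>k - k\<bar>" using that unfolding separated_def by blast
      then show False using assms(2) by simp
    qed
    have "\<exists>k. k \<in> support (\<psi> i)" if "i < R" for i
      using support_eq(3)[OF chi(1)[OF that]] chi(2)[OF that] by blast
    then obtain g where g: "\<And>i. i < R \<Longrightarrow> g i \<in> support (\<psi> i)" by metis
    have "inj_on g {..<R}" using g disj by (metis inj_onI lessThan_iff)
    moreover have "g ` {..<R} \<subseteq> support \<phi>"
    proof clarify
      fix i assume i: "i < R"
      obtain x where x: "\<psi> i (0(g i := x)) \<noteq> 1"
        using g[OF i] support_eq(2)[OF chi(1)[OF i]] by blast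
      have "\<psi> j (0(g i := x)) = 1" if "j < R" "j \<noteq> i" for j
        using disj[OF i that(1) _ g[OF i]] that support_eq(2)[OF chi(1)[OF that(1)]] by blast
      then have "(\<Prod>j<R. \<psi> j (0(g i := x))) = (\<Prod>j\<in>{i}. \<psi> j (0(g i := x)))"
        using i by (intro prod.mono_neutral_right) auto
      then have "\<phi> (0(g i := x)) \<noteq> 1"
        using f x by (simp add: separated_factorization_def)
      then show "g i \<in> support \<phi>" using support_eq(2)[OF ch] by blast
    qed
    ultimately show "R \<le> card (support \<phi>)"
      using card_inj_on_le[of g "{..<R}" "support \<phi>"] support_eq(1)[OF ch] by simp
  qed
qed simp

end

theory Submission
  imports Defs
begin

text \<open>
  Let \<open>K\<close> be the support of a character \<open>\<phi>\<close>, and call a point of \<open>K\<close> a cluster start if every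
  smaller point of \<open>K\<close> is at distance at least \<open>S\<close> from it. The factors of an \<open>S\<close>-separated
  factorization of \<open>\<phi>\<close> may interleave, but the least support point of each factor is a cluster
  start, so the rank of \<open>\<phi>\<close> is at most the number of cluster starts
  (\<open>separated_factorization_le_card_cluster_starts\<close>). Cutting \<open>K\<close> at its cluster starts thus yields
  a long factorization into nontrivial characters that live on successive intervals with
  gaps of length at least \<open>S\<close>.

  Uniform mixing is a statement about events. A character takes at most \<open>N\<close> values,
  where \<open>N\<close> is the order of the group (\<open>character_root_of_unity\<close>), so decomposing into level sets
  turns mixing with error \<open>\<eta>\<close> into
  \<open>|\<langle>\<phi>\<psi>, \<mu>\<rangle> - \<langle>\<phi>, \<mu>\<rangle>\<langle>\<psi>, \<mu>\<rangle>| \<le> N\<^sup>2 \<eta> = \<delta>\<close>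
  for characters \<open>\<phi>\<close> and \<open>\<psi>\<close> on two sides of a long gap (\<open>fourier_coeff_mult_approx\<close>).
  Splitting off the last cluster, whose coefficient is at most \<open>C < 1\<close> in modulus
  by harmonic boundedness, replaces a bound \<open>b\<close> by \<open>C b + \<delta>\<close>. The map \<open>b \<mapsto> C b + \<delta>\<close>
  is a contraction by \<open>C\<close> towards its fixed point \<open>\<delta> / (1 - C)\<close>, so after \<open>n\<close> clusters the coefficient is at most
  \<open>C\<^sup>n + \<delta> / (1 - C)\<close> (\<open>fourier_coeff_cluster_bound\<close>). Choosing \<open>\<delta>\<close> small makes
  the second term \<open>\<epsilon> / 2\<close> and fixes \<open>S\<close>; choosing \<open>n\<close> large makes the first smaller than
  \<open>\<epsilon> / 2\<close> and fixes \<open>R\<close>.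
\<close>

section \<open>Shift invariance and mixing across an arbitrary gap\<close>

lemma continuous_on_shift: "continuous_on UNIV (shift m :: (int \<Rightarrow> 'a::topological_space) \<Rightarrow> _)"
  unfolding shift_def
  by (intro continuous_on_coordinatewise_then_product continuous_on_product_coordinates)

lemma shift_measurable [measurable]: "(shift m :: (int \<Rightarrow> 'a::topological_space) \<Rightarrow> _) \<in> borel \<rightarrow>\<^sub>M borel"
  by (rule borel_measurable_continuous_onI[OF continuous_on_shift])

lemma shift_shift: "shift m (shift n a) = shift (m + n) a"
  by (simp add: shift_def add.assoc)

lemma shift_zero: "shift 0 a = a"
  by (simp add: shift_def)

lemma shift_vimage_vimage: "shift m -` (shift n -` A) = shift (m + n) -` A"
  by (auto simp: shift_shift add.commute)

lemma shift_image_eq_vimage: "shift m ` A = shift (- m) -` A"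
proof
  show "shift (- m) -` A \<subseteq> shift m ` A"
  proof
    fix b assume "b \<in> shift (- m) -` A"
    moreover have "b = shift m (shift (- m) b)" by (simp add: shift_shift shift_zero)
    ultimately show "b \<in> shift m ` A" by blast
  qed
qed (auto simp: shift_shift shift_zero)

lemma measure_shift_vimage:
  fixes \<mu> :: "(int \<Rightarrow> 'a::topological_space) measure"
  assumes "shift_invariant \<mu>" "sets \<mu> = sets borel" "A \<in> sets borel"
  shows "measure \<mu> (shift m -` A) = measure \<mu> A"
proof -
  have sp: "space \<mu> = UNIV" using sets_eq_imp_space_eq[OF assms(2)] by simp
  have meas: "shift k -` B \<in> sets borel" if "B \<in> sets borel" for k and B :: "(int \<Rightarrow> 'a) set"
    using measurable_sets[OF shift_measurable that] by simp
  have one: "measure \<mu> (shift 1 -` B) = measure \<mu> B" if "B \<in> sets borel" for B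
  proof -
    have "shift 1 \<in> \<mu> \<rightarrow>\<^sub>M borel" using shift_measurable by (simp cong: measurable_cong_sets add: assms(2))
    then have "measure (distr \<mu> borel (shift 1)) B = measure \<mu> (shift 1 -` B)"
      using that by (simp add: measure_distr sp)
    then show ?thesis using assms(1) by (simp add: shift_invariant_def)
  qed
  have nat: "measure \<mu> (shift (int n) -` B) = measure \<mu> B" if "B \<in> sets borel" for n B
  proof (induction n)
    case 0
    then show ?case by (simp add: shift_zero vimage_def)
  next
    case (Suc n)
    then show ?case
      using one[OF meas[OF that, of "int n"]] by (simp add: shift_vimage_vimage)
  qed
  show ?thesis
  proof (cases "m \<ge> 0")
    case True
    then show ?thesis using nat[OF assms(3), of "nat m"] by simp
  next
    case False
    then have "measure \<mu> (shift (- m) -` (shift m -` A)) = measure \<mu> (shift m -` A)"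
      using nat[OF meas[OF assms(3), of m], of "nat (- m)"] by simp
    then show ?thesis by (simp add: shift_shift shift_zero vimage_def)
  qed
qed

lemma depends_on_finitely_many_shift_vimage:
  assumes "depends_on_finitely_many J A" "\<And>k. k \<in> J \<Longrightarrow> k + m \<in> J'"
  shows "depends_on_finitely_many J' (shift m -` A)"
proof -
  obtain F where F: "F \<subseteq> J" "finite F" "\<And>a b. (\<forall>k\<in>F. a k = b k) \<Longrightarrow> a \<in> A \<longleftrightarrow> b \<in> A"
    using assms(1) unfolding depends_on_finitely_many_def by metis
  show ?thesis unfolding depends_on_finitely_many_def
  proof (intro exI[of _ "(\<lambda>k. k + m) ` F"] conjI allI impI)
    fix a b :: "int \<Rightarrow> 'a"
    assume "\<forall>k\<in>(\<lambda>k. k + m) ` F. a k = b k"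
    then show "a \<in> shift m -` A \<longleftrightarrow> b \<in> shift m -` A"
      using F(3)[of "shift m a" "shift m b"] by (simp add: shift_def)
  qed (use F assms(2) in auto)
qed

text \<open>
  Uniform mixing speaks of events on the two sides of the origin, one of which is then moved
  away. By shift invariance both events may be moved, so only the gap between them matters.
\<close>

lemma uniformly_mixing_gap:
  fixes \<mu> :: "(int \<Rightarrow> 'a::topological_space) measure"
  assumes "uniformly_mixing \<mu>" "sets \<mu> = sets borel" "\<epsilon> > 0"
  obtains M where "M > 0"
    "\<And>A B g m. \<lbrakk>m > M; A \<in> sets borel; B \<in> sets borel;
       depends_on_finitely_many {..g - m} A; depends_on_finitely_many {g..} B\<rbrakk> \<Longrightarrow>
       \<bar>measure \<mu> (A \<inter> B) - measure \<mu> A * measure \<mu> B\<bar> < \<epsilon>"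
proof -
  have inv: "shift_invariant \<mu>" using assms(1) by (simp add: uniformly_mixing_def)
  obtain M where M: "M > 0"
    "\<And>L R m. depends_on_finitely_many {..0} L \<Longrightarrow> depends_on_finitely_many {0..} R \<Longrightarrow> m > M \<Longrightarrow>
       \<bar>measure \<mu> (shift m ` L \<inter> R) - measure \<mu> L * measure \<mu> R\<bar> < \<epsilon>"
    using assms(1,3) unfolding uniformly_mixing_def by metis
  show ?thesis
  proof (rule that[OF M(1)])
    fix A B :: "(int \<Rightarrow> 'a) set" and g m
    assume *: "m > M" "A \<in> sets borel" "B \<in> sets borel"
       "depends_on_finitely_many {..g - m} A" "depends_on_finitely_many {g..} B"
    let ?L = "shift (m - g) -` A" and ?R = "shift (- g) -` B"
    have "depends_on_finitely_many {..0} ?L" "depends_on_finitely_many {0..} ?R"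
      using *(4,5) by (auto elim!: depends_on_finitely_many_shift_vimage)
    from M(2)[OF this *(1)]
    have "\<bar>measure \<mu> (shift m ` ?L \<inter> ?R) - measure \<mu> ?L * measure \<mu> ?R\<bar> < \<epsilon>" .
    moreover have "shift m ` ?L \<inter> ?R = shift (- g) -` (A \<inter> B)"
      by (simp add: shift_image_eq_vimage shift_vimage_vimage)
    ultimately show "\<bar>measure \<mu> (A \<inter> B) - measure \<mu> A * measure \<mu> B\<bar> < \<epsilon>"
      using *(2,3) by (simp add: measure_shift_vimage[OF inv assms(2)] del: vimage_Int)
  qed
qed

section \<open>From events to characters\<close>

lemma integral_finite_range_mult:
  fixes f h :: "'b \<Rightarrow> complex"
  assumes "finite_measure M" "finite V"
    and "\<And>x. f x \<in> V" "\<And>x. h x \<in> V"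
    and "\<And>z w. z \<in> V \<Longrightarrow> w \<in> V \<Longrightarrow> f -` {z} \<inter> h -` {w} \<in> sets M"
  shows "(\<integral>x. f x * h x \<partial>M) = (\<Sum>z\<in>V. \<Sum>w\<in>V. z * w * measure M (f -` {z} \<inter> h -` {w}))"
proof -
  interpret finite_measure M by fact
  have "f x * h x = (\<Sum>z\<in>V. \<Sum>w\<in>V. indicat_real (f -` {z} \<inter> h -` {w}) x *\<^sub>R (z * w))" for x
  proof -
    have "(\<Sum>z\<in>V. \<Sum>w\<in>V. indicat_real (f -` {z} \<inter> h -` {w}) x *\<^sub>R (z * w))
        = (\<Sum>z\<in>V. if z = f x then \<Sum>w\<in>V. if w = h x then z * w else 0 else 0)"
      by (intro sum.cong) (auto simp: indicator_def intro!: sum.cong)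
    also have "\<dots> = f x * h x" using assms(2-4) by simp
    finally show ?thesis ..
  qed
  from Bochner_Integration.integral_cong[OF refl this]
  have "(\<integral>x. f x * h x \<partial>M)
      = (\<integral>x. (\<Sum>z\<in>V. \<Sum>w\<in>V. indicat_real (f -` {z} \<inter> h -` {w}) x *\<^sub>R (z * w)) \<partial>M)" .
  also have "\<dots> = (\<Sum>z\<in>V. \<Sum>w\<in>V. \<integral>x. indicat_real (f -` {z} \<inter> h -` {w}) x *\<^sub>R (z * w) \<partial>M)"
    using assms(5) by (simp add: Bochner_Integration.integral_sum less_top[symmetric])
  also have "\<dots> = (\<Sum>z\<in>V. \<Sum>w\<in>V. z * w * measure M (f -` {z} \<inter> h -` {w}))"
    using assms(5) by (intro sum.cong refl) (simp add: less_top[symmetric] scaleR_conv_of_real sets.Int_space_eq2)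
  finally show ?thesis .
qed

lemma integral_finite_range:
  fixes f :: "'b \<Rightarrow> complex"
  assumes "finite_measure M" "finite V" "\<And>x. f x \<in> V" "\<And>z. z \<in> V \<Longrightarrow> f -` {z} \<in> sets M"
  shows "(\<integral>x. f x \<partial>M) = (\<Sum>z\<in>V. z * measure M (f -` {z}))"
proof -
  interpret finite_measure M by fact
  have "f x = (\<Sum>z\<in>V. indicat_real (f -` {z}) x *\<^sub>R z)" for x
  proof -
    have "(\<Sum>z\<in>V. indicat_real (f -` {z}) x *\<^sub>R z) = (\<Sum>z\<in>V. if z = f x then z else 0)"
      by (intro sum.cong) (auto simp: indicator_def)
    then show ?thesis using assms(2,3) by simp
  qed
  from Bochner_Integration.integral_cong[OF refl this]
  have "(\<integral>x. f x \<partial>M) = (\<integral>x. (\<Sum>z\<in>V. indicat_real (f -` {z}) x *\<^sub>R z) \<partial>M)" .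
  also have "\<dots> = (\<Sum>z\<in>V. z * measure M (f -` {z}))"
    using assms(4)
    by (simp add: Bochner_Integration.integral_sum less_top[symmetric] scaleR_conv_of_real
        sets.Int_space_eq2 mult.commute)
  finally show ?thesis .
qed

text \<open>
  Both sides expand into sums over pairs of values, and each of the \<open>(card V)\<^sup>2\<close> pairs of level
  sets contributes at most one error \<open>\<eta>\<close>.
\<close>

lemma integral_mult_approx:
  fixes f h :: "'b \<Rightarrow> complex"
  assumes "finite_measure M" "finite V"
    and "\<And>x. f x \<in> V" "\<And>x. h x \<in> V" "\<And>z. z \<in> V \<Longrightarrow> cmod z \<le> 1"
    and "\<And>z. z \<in> V \<Longrightarrow> f -` {z} \<in> sets M" "\<And>z. z \<in> V \<Longrightarrow> h -` {z} \<in> sets M"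
    and "\<And>z w. z \<in> V \<Longrightarrow> w \<in> V \<Longrightarrow>
       \<bar>measure M (f -` {z} \<inter> h -` {w}) - measure M (f -` {z}) * measure M (h -` {w})\<bar> \<le> \<eta>"
  shows "cmod ((\<integral>x. f x * h x \<partial>M) - (\<integral>x. f x \<partial>M) * (\<integral>x. h x \<partial>M)) \<le> (real (card V))\<^sup>2 * \<eta>"
proof -
  define d where "d z w = measure M (f -` {z} \<inter> h -` {w}) - measure M (f -` {z}) * measure M (h -` {w})" for z w
  have "(\<integral>x. f x * h x \<partial>M) - (\<integral>x. f x \<partial>M) * (\<integral>x. h x \<partial>M)
      = (\<Sum>z\<in>V. \<Sum>w\<in>V. z * w * measure M (f -` {z} \<inter> h -` {w}))
        - (\<Sum>z\<in>V. z * measure M (f -` {z})) * (\<Sum>w\<in>V. w * measure M (h -` {w}))"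
    using integral_finite_range_mult[of M V f h] integral_finite_range[of M V f]
      integral_finite_range[of M V h] assms by auto
  also have "\<dots> = (\<Sum>z\<in>V. \<Sum>w\<in>V. z * w * d z w)"
    by (simp add: d_def sum_product sum_subtractf[symmetric] algebra_simps)
  finally have "cmod ((\<integral>x. f x * h x \<partial>M) - (\<integral>x. f x \<partial>M) * (\<integral>x. h x \<partial>M))
      \<le> (\<Sum>z\<in>V. \<Sum>w\<in>V. cmod (z * w * d z w))"
    by (auto intro!: order.trans[OF norm_sum] sum_mono)
  also have "\<dots> \<le> (\<Sum>z\<in>V. \<Sum>w\<in>V. \<eta>)"
  proof (intro sum_mono)
    fix z w assume *: "z \<in> V" "w \<in> V"
    have "cmod z * cmod w * \<bar>d z w\<bar> \<le> 1 * \<bar>d z w\<bar>"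
      using assms(5) * by (intro mult_right_mono mult_le_one) auto
    then show "cmod (z * w * d z w) \<le> \<eta>"
      using assms(8)[OF *] by (simp add: norm_mult d_def[symmetric])
  qed
  finally show ?thesis by (simp add: power2_eq_square mult.assoc)
qed

lemma product_form_character:
  assumes "product_form \<phi> K c"
  shows "character \<phi>"
proof -
  have eq: "\<phi> = (\<lambda>a. \<Prod>k\<in>K. c k (a k))" and c: "\<And>k. k \<in> K \<Longrightarrow> character (c k)"
    using assms by (auto simp: product_form_def nontrivial_character_def)
  have "continuous_on UNIV \<phi>" unfolding eq
  proof (rule continuous_on_prod)
    fix k assume "k \<in> K"
    then have "continuous_on UNIV (c k)" using c by (simp add: character_def)
    then show "continuous_on UNIV (\<lambda>a. c k (a k))"
      by (rule continuous_on_compose2) auto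
  qed
  moreover have "cmod (\<phi> x) = 1" for x
    using c by (simp add: eq prod_norm[symmetric] character_def)
  moreover have "\<phi> (x + y) = \<phi> x * \<phi> y" for x y
    using c by (simp add: eq prod.distrib[symmetric] character_def cong: prod.cong)
  ultimately show ?thesis by (simp add: character_def)
qed

lemma product_form_nontrivial:
  assumes "product_form \<phi> K c" "K \<noteq> {}"
  shows "nontrivial_character \<phi>"
  using product_form_support[OF assms(1)] product_form_character[OF assms(1)] assms(2)
  by (auto simp: nontrivial_character_def)

lemma product_form_level_set_depends:
  assumes "product_form \<phi> K c" "K \<subseteq> J"
  shows "depends_on_finitely_many J (\<phi> -` {z})"
proof -
  have "\<phi> a = \<phi> b" if "\<forall>k\<in>K. a k = b k" for a b
    using assms(1) that by (simp add: product_form_def cong: prod.cong)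
  then show ?thesis
    using assms unfolding depends_on_finitely_many_def product_form_def
    by (intro exI[of _ K]) auto
qed

lemma fourier_coeff_mult_approx:
  fixes \<mu> :: "(int \<Rightarrow> 'a :: {finite, ab_group_add, discrete_topology}) measure"
  assumes "prob_space \<mu>" "sets \<mu> = sets borel" "uniformly_mixing \<mu>" "\<delta> > 0"
  obtains M where "M > 0"
    "\<And>\<phi> \<psi> K L c d g m. \<lbrakk>m > M; product_form \<phi> K c; product_form \<psi> L d; K \<subseteq> {..g - m}; L \<subseteq> {g..}\<rbrakk> \<Longrightarrow>
       cmod (fourier_coeff (\<lambda>a. \<phi> a * \<psi> a) \<mu> - fourier_coeff \<phi> \<mu> * fourier_coeff \<psi> \<mu>) \<le> \<delta>"
proof -
  interpret prob_space \<mu> by fact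
  define V where "V = {z :: complex. z ^ CARD('a) = 1}"
  have finV: "finite V" unfolding V_def by (rule finite_roots_unity) (simp add: Suc_le_eq)
  have "1 \<in> V" by (simp add: V_def)
  then have pos: "card V > 0" using finV card_gt_0_iff by blast
  have normV: "cmod z \<le> 1" if "z \<in> V" for z
    using that power_eq_1_iff[of z "CARD('a)"] by (simp add: V_def)
  define \<eta> where "\<eta> = \<delta> / (real (card V))\<^sup>2"
  have "\<eta> > 0" using assms(4) pos by (simp add: \<eta>_def)
  then obtain M where M: "M > 0"
    "\<And>A B g m. \<lbrakk>m > M; A \<in> sets borel; B \<in> sets borel;
       depends_on_finitely_many {..g - m} A; depends_on_finitely_many {g..} B\<rbrakk> \<Longrightarrow>
       \<bar>measure \<mu> (A \<inter> B) - measure \<mu> A * measure \<mu> B\<bar> < \<eta>"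
    using uniformly_mixing_gap[OF assms(3,2)] by blast
  show ?thesis
  proof (rule that[OF M(1)])
    fix \<phi> \<psi> :: "(int \<Rightarrow> 'a) \<Rightarrow> complex" and K L c d g m
    assume *: "m > M" "product_form \<phi> K c" "product_form \<psi> L d" "K \<subseteq> {..g - m}" "L \<subseteq> {g..}"
    have ch: "character \<phi>" "character \<psi>" using *(2,3) product_form_character by blast+
    have level: "\<theta> -` {z} \<in> sets borel" if "character \<theta>" for \<theta> :: "(int \<Rightarrow> 'a) \<Rightarrow> complex" and z
      using that by (intro borel_closed closed_vimage) (auto simp: character_def)
    have "cmod (fourier_coeff (\<lambda>a. \<phi> a * \<psi> a) \<mu> - fourier_coeff \<phi> \<mu> * fourier_coeff \<psi> \<mu>)
        \<le> (real (card V))\<^sup>2 * \<eta>"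
      unfolding fourier_coeff_def
    proof (rule integral_mult_approx[OF finite_measure_axioms finV _ _ normV])
      show "\<phi> x \<in> V" "\<psi> x \<in> V" for x
        using ch character_root_of_unity by (auto simp: V_def)
      show "\<phi> -` {z} \<in> sets \<mu>" "\<psi> -` {z} \<in> sets \<mu>" for z
        using level ch assms(2) by auto
      show "\<bar>measure \<mu> (\<phi> -` {z} \<inter> \<psi> -` {w}) - measure \<mu> (\<phi> -` {z}) * measure \<mu> (\<psi> -` {w})\<bar> \<le> \<eta>" for z w
        using M(2)[OF *(1) level[OF ch(1)] level[OF ch(2)]
            product_form_level_set_depends[OF *(2,4)] product_form_level_set_depends[OF *(3,5)]]
        by (rule less_imp_le)
    qed
    then show "cmod (fourier_coeff (\<lambda>a. \<phi> a * \<psi> a) \<mu> - fourier_coeff \<phi> \<mu> * fourier_coeff \<psi> \<mu>) \<le> \<delta>"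
      using pos by (simp add: \<eta>_def)
  qed
qed

section \<open>Cluster starts\<close>

definition cluster_starts :: "nat \<Rightarrow> int set \<Rightarrow> int set" where
  "cluster_starts S K = {k\<in>K. \<forall>j\<in>K. j < k \<longrightarrow> j \<le> k - int S}"

lemma cluster_starts_below:
  assumes "g \<in> cluster_starts S K"
  shows "K \<inter> {..<g} \<subseteq> {..g - int S}"
  using assms by (auto simp: cluster_starts_def)

lemma cluster_starts_restrict_below: "cluster_starts S (K \<inter> {..<g}) = cluster_starts S K \<inter> {..<g}"
  by (auto simp: cluster_starts_def)

lemma support_separated_factorization:
  fixes \<phi> :: "(int \<Rightarrow> 'a :: {finite, ab_group_add, discrete_topology}) \<Rightarrow> complex"
  assumes "separated_factorization S \<phi> r \<psi>" "S > 0" "character \<phi>"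
  shows "support \<phi> = (\<Union>i<r. support (\<psi> i))"
proof (rule set_eqI)
  fix k
  have eq: "\<phi> a = (\<Prod>i<r. \<psi> i a)" and ch: "i < r \<Longrightarrow> character (\<psi> i)" for a i
    using assms(1) by (auto simp: separated_factorization_def nontrivial_character_def)
  have supp: "k \<in> support (\<psi> i) \<longleftrightarrow> (\<exists>x. \<psi> i (0(k := x)) \<noteq> 1)" if "i < r" for i
    using support_eq(2)[OF ch[OF that]] by blast
  show "k \<in> support \<phi> \<longleftrightarrow> k \<in> (\<Union>i<r. support (\<psi> i))"
  proof
    assume "k \<in> support \<phi>"
    then obtain x where "(\<Prod>i<r. \<psi> i (0(k := x))) \<noteq> 1"
      using support_eq(2)[OF assms(3)] eq by auto
    then obtain i where "i < r" "\<psi> i (0(k := x)) \<noteq> 1"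
      using prod.neutral[of "{..<r}"] by (metis lessThan_iff)
    then show "k \<in> (\<Union>i<r. support (\<psi> i))" using supp by blast
  next
    assume "k \<in> (\<Union>i<r. support (\<psi> i))"
    then obtain i where i: "i < r" "k \<in> support (\<psi> i)" by auto
    then obtain x where x: "\<psi> i (0(k := x)) \<noteq> 1" using supp by blast
    \<comment> \<open>As \<open>S > 0\<close>, the supports of the factors are disjoint, so no other factor can cancel \<open>\<psi> i\<close> at \<open>k\<close>.\<close>
    have "k \<notin> support (\<psi> j)" if "j < r" "j \<noteq> i" for j
    proof
      assume "k \<in> support (\<psi> j)"
      moreover have "separated S (\<psi> i) (\<psi> j)"
        using assms(1) that i(1) by (auto simp: separated_factorization_def)
      ultimately have "int S \<le> \<bar>k - k\<bar>" using i(2) unfolding separated_def by blast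
      then show False using assms(2) by simp
    qed
    then have "(\<Prod>j<r. \<psi> j (0(k := x))) = (\<Prod>j\<in>{i}. \<psi> j (0(k := x)))"
      using i(1) supp by (intro prod.mono_neutral_right) auto
    then show "k \<in> support \<phi>" using x eq support_eq(2)[OF assms(3)] by auto
  qed
qed

text \<open>
  Write \<open>\<phi>\<close> as the product of the factors \<open>\<psi> i\<close>.
  The points of the support of \<open>\<phi>\<close> below the least support point of a factor belong to other factors,
  so separation makes that least point a cluster start.
\<close>

lemma separated_factorization_le_card_cluster_starts:
  fixes \<phi> :: "(int \<Rightarrow> 'a :: {finite, ab_group_add, discrete_topology}) \<Rightarrow> complex"
  assumes "separated_factorization S \<phi> r \<psi>" "S > 0" "character \<phi>"
  shows "r \<le> card (cluster_starts S (support \<phi>))"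
proof -
  have ch: "character (\<psi> i)" "\<psi> i \<noteq> (\<lambda>_. 1)" if "i < r" for i
    using assms(1) that by (auto simp: separated_factorization_def nontrivial_character_def)
  have sep: "\<bar>k - l\<bar> \<ge> int S" if "i < r" "j < r" "i \<noteq> j" "k \<in> support (\<psi> i)" "l \<in> support (\<psi> j)" for i j k l
    using assms(1) that by (auto simp: separated_factorization_def separated_def)
  define p where "p i = Min (support (\<psi> i))" for i
  have fin: "finite (support (\<psi> i))" if "i < r" for i
    using support_eq(1) ch that by blast
  have p: "p i \<in> support (\<psi> i)" if "i < r" for i
    unfolding p_def using fin ch that support_eq(3)[of "\<psi> i"] by (intro Min_in) auto
  have "inj_on p {..<r}"
  proof (rule inj_onI, rule ccontr)
    fix i j assume ij: "i \<in> {..<r}" "j \<in> {..<r}" "p i = p j" "i \<noteq> j"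
    then have "int S \<le> \<bar>p i - p j\<bar>" using sep[OF _ _ _ p p] by blast
    then show False using ij(3) assms(2) by simp
  qed
  moreover have "p ` {..<r} \<subseteq> cluster_starts S (support \<phi>)"
  proof clarify
    fix i assume i: "i < r"
    have "l \<le> p i - int S" if l: "l \<in> support \<phi>" "l < p i" for l
    proof -
      obtain j where j: "j < r" "l \<in> support (\<psi> j)"
        using l(1) support_separated_factorization[OF assms] by auto
      have "j \<noteq> i" using j(2) l(2) Min_le[OF fin[OF i], of l] by (auto simp: p_def)
      then show ?thesis using sep[OF i j(1) _ p[OF i] j(2)] l(2) by auto
    qed
    then show "p i \<in> cluster_starts S (support \<phi>)"
      using i p support_separated_factorization[OF assms] by (auto simp: cluster_starts_def)
  qed
  moreover have "finite (cluster_starts S (support \<phi>))"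
    using support_eq(1)[OF assms(3)] by (simp add: cluster_starts_def)
  ultimately show ?thesis using card_inj_on_le[of p "{..<r}"] by simp
qed

section \<open>Decay of the Fourier coefficients\<close>

text \<open>
  The cut is made at the last cluster start: the part on its right is then a nontrivial character,
  and the part on its left keeps all the other cluster starts, because whether a
  point is a cluster start depends only on what lies below it.
\<close>

lemma fourier_coeff_cluster_bound:
  fixes \<mu> :: "(int \<Rightarrow> 'a :: {finite, ab_group_add, discrete_topology}) measure"
  assumes "prob_space \<mu>" "0 \<le> C" "C < 1" "0 \<le> \<delta>"
    and bounded: "\<And>\<phi>. nontrivial_character \<phi> \<Longrightarrow> cmod (fourier_coeff \<phi> \<mu>) \<le> C"
    and mix: "\<And>\<phi> \<psi> K L c d g. \<lbrakk>product_form \<phi> K c; product_form \<psi> L d; K \<subseteq> {..g - int S}; L \<subseteq> {g..}\<rbrakk> \<Longrightarrow>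
       cmod (fourier_coeff (\<lambda>a. \<phi> a * \<psi> a) \<mu> - fourier_coeff \<phi> \<mu> * fourier_coeff \<psi> \<mu>) \<le> \<delta>"
    and "product_form \<phi> K c" "n \<le> card (cluster_starts S K)"
  shows "cmod (fourier_coeff \<phi> \<mu>) \<le> C ^ n + \<delta> / (1 - C)"
  using assms(7,8)
proof (induction n arbitrary: \<phi> K)
  case 0
  interpret prob_space \<mu> by fact
  have "cmod (\<phi> x) = 1" for x
    using product_form_character[OF 0(1)] by (simp add: character_def)
  then have "cmod (fourier_coeff \<phi> \<mu>) \<le> 1"
    using integral_norm_bound[of \<mu> \<phi>] by (simp add: fourier_coeff_def prob_space)
  then show ?case using assms(3,4) by (simp add: add_increasing2)
next
  case (Suc n)
  let ?G = "cluster_starts S K"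
  have pf: "finite K" "\<And>k. k \<in> K \<Longrightarrow> nontrivial_character (c k)" "\<phi> = (\<lambda>a. \<Prod>k\<in>K. c k (a k))"
    using Suc.prems(1) by (auto simp: product_form_def)
  have finG: "finite ?G" using pf(1) by (simp add: cluster_starts_def)
  have neG: "?G \<noteq> {}" using Suc.prems(2) by auto
  define g where "g = Max ?G"
  have g: "g \<in> ?G" unfolding g_def by (rule Max_in[OF finG neG])
  define K1 where "K1 = K \<inter> {..<g}"
  define K2 where "K2 = K \<inter> {g..}"
  define \<phi>1 where "\<phi>1 = (\<lambda>a. \<Prod>k\<in>K1. c k (a k))"
  define \<phi>2 where "\<phi>2 = (\<lambda>a. \<Prod>k\<in>K2. c k (a k))"
  have p1: "product_form \<phi>1 K1 c" and p2: "product_form \<phi>2 K2 c"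
    using pf by (auto simp: product_form_def K1_def K2_def \<phi>1_def \<phi>2_def)
  have "K = K1 \<union> K2" "K1 \<inter> K2 = {}" by (auto simp: K1_def K2_def)
  then have "\<phi> = (\<lambda>a. \<phi>1 a * \<phi>2 a)"
    using pf(1) unfolding pf(3) \<phi>1_def \<phi>2_def by (auto intro!: ext prod.union_disjoint)
  then have "cmod (fourier_coeff \<phi> \<mu> - fourier_coeff \<phi>1 \<mu> * fourier_coeff \<phi>2 \<mu>) \<le> \<delta>"
    using mix[OF p1 p2, of g] cluster_starts_below[OF g] by (auto simp: K1_def K2_def)
  then have step: "cmod (fourier_coeff \<phi> \<mu>) \<le> cmod (fourier_coeff \<phi>1 \<mu>) * cmod (fourier_coeff \<phi>2 \<mu>) + \<delta>"
    by (smt (verit) norm_mult norm_triangle_ineq2)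
  have "g \<in> K2" using g by (simp add: K2_def cluster_starts_def)
  then have c2: "cmod (fourier_coeff \<phi>2 \<mu>) \<le> C"
    using bounded[OF product_form_nontrivial[OF p2]] by blast
  have "cluster_starts S K1 = ?G - {g}"
    unfolding K1_def cluster_starts_restrict_below using Max_ge[OF finG] by (force simp: g_def)
  then have "n \<le> card (cluster_starts S K1)"
    using Suc.prems(2) g finG by simp
  then have c1: "cmod (fourier_coeff \<phi>1 \<mu>) \<le> C ^ n + \<delta> / (1 - C)"
    by (rule Suc.IH[OF p1])
  have "cmod (fourier_coeff \<phi> \<mu>) \<le> (C ^ n + \<delta> / (1 - C)) * C + \<delta>"
    using step mult_mono[OF c1 c2] assms(2-4) by (simp add: add_nonneg_nonneg)
  also have "\<dots> = C ^ Suc n + \<delta> / (1 - C)"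
    using assms(3) by (simp add: field_simps)
  finally show ?case .
qed

theorem theorem5p2:
  fixes \<mu> :: "(int \<Rightarrow> 'a :: {finite, ab_group_add, discrete_topology}) measure"
  assumes "prob_space \<mu>"
    and "sets \<mu> = sets borel"
    and "uniformly_mixing \<mu>"
    and "harmonically_bounded \<mu>"
  shows "dispersion_mixing \<mu>"
  unfolding dispersion_mixing_def
proof (intro allI impI)
  fix \<epsilon> :: real assume \<epsilon>: "\<epsilon> > 0"
  obtain C0 where C0: "C0 < 1" "\<And>\<phi>. nontrivial_character \<phi> \<Longrightarrow> cmod (fourier_coeff \<phi> \<mu>) < C0"
    using assms(4) unfolding harmonically_bounded_def by blast
  \<comment> \<open>Over the trivial group there are no nontrivial characters, and the given constant may be negative.\<close>
  define C where "C = max C0 0"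
  have C: "0 \<le> C" "C < 1" and bounded: "\<And>\<phi>. nontrivial_character \<phi> \<Longrightarrow> cmod (fourier_coeff \<phi> \<mu>) \<le> C"
    using C0 by (auto simp: C_def intro: less_imp_le max.coboundedI1)
  define \<delta> where "\<delta> = \<epsilon> / 2 * (1 - C)"
  have \<delta>: "\<delta> > 0" using \<epsilon> C by (simp add: \<delta>_def)
  obtain M where M: "M > 0"
    "\<And>\<phi> \<psi> K L c d g m. \<lbrakk>m > M; product_form \<phi> K c; product_form \<psi> L d; K \<subseteq> {..g - m}; L \<subseteq> {g..}\<rbrakk> \<Longrightarrow>
       cmod (fourier_coeff (\<lambda>a. \<phi> a * \<psi> a) \<mu> - fourier_coeff \<phi> \<mu> * fourier_coeff \<psi> \<mu>) \<le> \<delta>"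
    using fourier_coeff_mult_approx[OF assms(1-3) \<delta>] by blast
  define S where "S = nat M + 1"
  have S: "int S > M" "S > 0" using M(1) by (auto simp: S_def)
  obtain R0 where "C ^ R0 < \<epsilon> / 2"
    using real_arch_pow_inv[of "\<epsilon> / 2" C] \<epsilon> C(2) by auto
  then have R: "C ^ Suc R0 < \<epsilon> / 2"
    using C power_decreasing[of R0 "Suc R0" C] by simp
  have "cmod (fourier_coeff \<phi> \<mu>) < \<epsilon>" if \<phi>: "character \<phi>" "sep_rank S \<phi> > Suc R0"
    for \<phi> :: "(int \<Rightarrow> 'a) \<Rightarrow> complex"
  proof -
    let ?ranks = "{r. \<exists>\<psi>. separated_factorization S \<phi> r \<psi>}"
    have "\<phi> \<noteq> (\<lambda>_. 1)" using \<phi>(2) by (auto simp: sep_rank_def)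
    then have nt: "nontrivial_character \<phi>" and rank: "sep_rank S \<phi> = Max ?ranks"
      using \<phi>(1) by (auto simp: nontrivial_character_def sep_rank_def)
    have "sep_rank S \<phi> \<in> ?ranks"
      unfolding rank using finite_ranks[OF nt S(2)] one_in_ranks[OF nt, of S] by (intro Max_in) blast+
    then have "Suc R0 \<le> card (cluster_starts S (support \<phi>))"
      using separated_factorization_le_card_cluster_starts[OF _ S(2) \<phi>(1)] \<phi>(2) by fastforce
    moreover obtain c where "product_form \<phi> (support \<phi>) c"
      using theI'[OF ex1_product_form[OF \<phi>(1)]] unfolding support_def by blast
    ultimately have "cmod (fourier_coeff \<phi> \<mu>) \<le> C ^ Suc R0 + \<delta> / (1 - C)"
      using fourier_coeff_cluster_bound[where S = S, OF assms(1) C less_imp_le[OF \<delta>] bounded]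
        M(2)[OF S(1)] by blast
    also have "\<delta> / (1 - C) = \<epsilon> / 2"
      unfolding \<delta>_def using C(2) by (intro nonzero_mult_div_cancel_right) auto
    finally show ?thesis using R by simp
  qed
  then show "\<exists>S>0. \<exists>R>0. \<forall>\<phi>. character \<phi> \<longrightarrow> sep_rank S \<phi> > R \<longrightarrow> cmod (fourier_coeff \<phi> \<mu>) < \<epsilon>"
    using S(2) by blast
qed

end
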